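(* Let $\mathbf{M}_{\rho} = \langle S,A_{\rho},\Omega,T_{\rho},O_{\rho},\Gamma_{\rho},b_0,h\rangle$ be a $\rho$POMDP and let $\pi_{\rho}$ be an arbitrary policy for $\mathbf{M}_{\rho}$. Let $\mathbf{M}_{\mathit{IR}}$ be the POMDP-IR obtained from $\mathbf{M}_{\rho}$ by the reduction REDUCE-POMDP-$\rho$-IR, and let $\pi_{\mathit{IR}}$ be the policy for $\mathbf{M}_{\mathit{IR}}$ obtained from $\pi_{\rho}$ by the reduction REDUCE-POLICY-$\rho$-IR. Then, for all beliefs $b$ and all $t\ge 0$, $$V_{t}^{\mathit{IR}}(b) = V_{t}^{\rho}(b),$$ where $V_t^{\mathit{IR}}$ is the $t$-step value function of $\pi_{\mathit{IR}}$ in $\mathbf{M}_{\mathit{IR}}$ and $V_t^{\rho}$ is the $t$-step value function of $\pi_{\rho}$ in $\mathbf{M}_{\rho}$.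
   Context: All sets are finite. A belief is a probability distribution $b$ on the state set $S$. With transition function $T(s,\mathbf a,s')=\Pr(s'|s,\mathbf a)$ and observation function $O(s',\mathbf a,\mathbf z)=\Pr(\mathbf z|s',\mathbf a)$, put $\Pr(\mathbf z|b,\mathbf a)=\sum_{s}\sum_{s'}O(s',\mathbf a,\mathbf z)T(s,\mathbf a,s')b(s)$, and let $b^{\mathbf a,\mathbf z}(s')=\frac{O(s',\mathbf a,\mathbf z)}{\Pr(\mathbf z|b,\mathbf a)}\sum_s b(s)T(s,\mathbf a,s')$ be the Bayes-updated belief (terms with $\Pr(\mathbf z|b,\mathbf a)=0$ are omitted from sums). A policy maps each belief to an action. $\rho$POMDP: a tuple $\langle S,A_\rho,\Omega,T_\rho,O_\rho,\Gamma_\rho,b_0,h\rangle$ with states $S$, actions $A_\rho$, observations $\Omega$, transition and observation functions $T_\rho,O_\rho$, a nonempty finite set $\Gamma_\rho$ of vectors $\alpha:S\to\mathbb R$, initial belief $b_0$ and horizon $h$. Its immediate reward is $\rho(b)=\max_{\alpha\in\Gamma_\rho}\sum_s b(s)\alpha(s)$. The value function of a policy $\pi_\rho$ is given by $V^\rho_0(b)=\rho(b)$ and, for $t\ge1$, $V^\rho_t(b)=\rho(b)+\sum_{\mathbf z\in\Omega}\Pr(\mathbf z|b,\pi_\rho(b))\,V^\rho_{t-1}(b^{\pi_\rho(b),\mathbf z})$. POMDP-IR: a POMDP whose actions are pairs $\langle \mathbf a_n,a_p\rangle\in A_n\times A_p$ (normal action, prediction action), where transitions and observations depend only on $\mathbf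 a_n$ and the reward $R(s,a_p)$ depends only on the state and $a_p$. For a policy $\pi_{\mathit{IR}}(b)=\langle\pi^n_{\mathit{IR}}(b),\pi^p_{\mathit{IR}}(b)\rangle$, the value function is given by $V^{\mathit{IR}}_0(b)=\sum_s b(s)R(s,\pi^p_{\mathit{IR}}(b))$ and, for $t\ge1$, $V^{\mathit{IR}}_t(b)=\sum_s b(s)R(s,\pi^p_{\mathit{IR}}(b))+\sum_{\mathbf z\in\Omega}\Pr(\mathbf z|b,\pi^n_{\mathit{IR}}(b))\,V^{\mathit{IR}}_{t-1}(b^{\pi^n_{\mathit{IR}}(b),\mathbf z})$. REDUCE-POMDP-$\rho$-IR$(\mathbf M_\rho)$ produces the POMDP-IR $\mathbf M_{\mathit{IR}}$ with: the same $S$, $\Omega$, $b_0$, $h$; normal actions $A_{n,\mathit{IR}}=A_\rho$; one prediction action $a_p$ for each vector $\alpha^{a_p}_\rho\in\Gamma_\rho$; $T_{\mathit{IR}}(s,\mathbf a_n,s')=T_\rho(s,\mathbf a,s')$ and $O_{\mathit{IR}}(s',\mathbf a_n,\mathbf z)=O_\rho(s',\mathbf a,\mathbf z)$, where $\mathbf a\in A_\rho$ corresponds to $\mathbf a_n$ (prediction actions are ignored); reward $R_{\mathit{IR}}(s,a_p)=\alpha^{a_p}_\rho(s)$. REDUCE-POLICY-$\rho$-IR$(\pi_\rho)$ produces $\pi_{\mathit{IR}}(b)=\big\langle \pi_\rho(b),\ \operatorname{argmax}_{a_p}\sum_s b(s)R_{\mathit{IR}}(s,a_p)\big\rangle$ (any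 maximizer). *)

theory Defs
  imports Complex_Main "HOL-Library.FuncSet"
begin

text \<open>Data shared by both models; functions are only meaningful on the given finite carriers.
  The type \<open>'a\<close> is that of the actions that influence transitions and observations,
  i.e. of the normal actions in the case of a POMDP-IR.\<close>

record ('s, 'a, 'z) decision_process =
  states :: "'s set"
  actions :: "'a set"
  observations :: "'z set"
  trans_prob :: "'s \<Rightarrow> 'a \<Rightarrow> 's \<Rightarrow> real"
  obs_prob :: "'s \<Rightarrow> 'a \<Rightarrow> 'z \<Rightarrow> real"
  init_belief :: "'s \<Rightarrow> real"
  horizon :: nat

record ('s, 'a, 'z) rho_pomdp = "('s, 'a, 'z) decision_process" +
  vectors :: "('s \<Rightarrow> real) set"

record ('s, 'a, 'z, 'p) pomdp_ir = "('s, 'a, 'z) decision_process" +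
  pred_actions :: "'p set"
  reward :: "'s \<Rightarrow> 'p \<Rightarrow> real"

definition distributions :: "'x set \<Rightarrow> ('x \<Rightarrow> real) set" where
  "distributions X = {p. (\<forall>x\<in>X. 0 \<le> p x) \<and> (\<Sum>x\<in>X. p x) = 1}"

text \<open>Beliefs vanish outside the state set, so that each distribution on the states is
  represented by exactly one function and policies cannot depend on irrelevant values.\<close>

definition beliefs :: "('s, 'a, 'z, 'm) decision_process_scheme \<Rightarrow> ('s \<Rightarrow> real) set" where
  "beliefs M = {b \<in> distributions (states M). \<forall>s. s \<notin> states M \<longrightarrow> b s = 0}"

definition wf_process :: "('s, 'a, 'z, 'm) decision_process_scheme \<Rightarrow> bool" where
  "wf_process M \<longleftrightarrow>
     finite (states M) \<and> finite (actions M) \<and> finite (observations M) \<and>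
     (\<forall>s\<in>states M. \<forall>a\<in>actions M. trans_prob M s a \<in> distributions (states M)) \<and>
     (\<forall>s'\<in>states M. \<forall>a\<in>actions M. obs_prob M s' a \<in> distributions (observations M)) \<and>
     init_belief M \<in> beliefs M"

definition is_rho_pomdp :: "('s, 'a, 'z) rho_pomdp \<Rightarrow> bool" where
  "is_rho_pomdp M \<longleftrightarrow> wf_process M \<and> finite (vectors M) \<and> vectors M \<noteq> {}"

definition is_pomdp_ir :: "('s, 'a, 'z, 'p) pomdp_ir \<Rightarrow> bool" where
  "is_pomdp_ir M \<longleftrightarrow> wf_process M \<and> finite (pred_actions M) \<and> pred_actions M \<noteq> {}"

definition obs_given_belief ::
    "('s, 'a, 'z, 'm) decision_process_scheme \<Rightarrow> ('s \<Rightarrow> real) \<Rightarrow> 'a \<Rightarrow> 'z \<Rightarrow> real" where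
  "obs_given_belief M b a z =
     (\<Sum>s\<in>states M. \<Sum>s'\<in>states M. obs_prob M s' a z * trans_prob M s a s' * b s)"

definition update ::
    "('s, 'a, 'z, 'm) decision_process_scheme \<Rightarrow> ('s \<Rightarrow> real) \<Rightarrow> 'a \<Rightarrow> 'z \<Rightarrow> 's \<Rightarrow> real" where
  "update M b a z s' =
     (if s' \<in> states M
      then obs_prob M s' a z / obs_given_belief M b a z * (\<Sum>s\<in>states M. b s * trans_prob M s a s')
      else 0)"

text \<open>Observations of probability 0, for which the updated belief is undefined, are omitted.\<close>

definition possible_obs ::
    "('s, 'a, 'z, 'm) decision_process_scheme \<Rightarrow> ('s \<Rightarrow> real) \<Rightarrow> 'a \<Rightarrow> 'z set" where
  "possible_obs M b a = {z \<in> observations M. obs_given_belief M b a z \<noteq> 0}"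

definition rho :: "('s, 'a, 'z) rho_pomdp \<Rightarrow> ('s \<Rightarrow> real) \<Rightarrow> real" where
  "rho M b = (MAX \<alpha>\<in>vectors M. \<Sum>s\<in>states M. b s * \<alpha> s)"

primrec value_rho ::
    "('s, 'a, 'z) rho_pomdp \<Rightarrow> (('s \<Rightarrow> real) \<Rightarrow> 'a) \<Rightarrow> nat \<Rightarrow> ('s \<Rightarrow> real) \<Rightarrow> real" where
  "value_rho M \<pi> 0 = (\<lambda>b. rho M b)"
| "value_rho M \<pi> (Suc t) = (\<lambda>b. rho M b +
     (\<Sum>z\<in>possible_obs M b (\<pi> b).
        obs_given_belief M b (\<pi> b) z * value_rho M \<pi> t (update M b (\<pi> b) z)))"

definition expected_reward ::
    "('s, 'a, 'z, 'p) pomdp_ir \<Rightarrow> ('s \<Rightarrow> real) \<Rightarrow> 'p \<Rightarrow> real" where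
  "expected_reward M b p = (\<Sum>s\<in>states M. b s * reward M s p)"

primrec value_ir ::
    "('s, 'a, 'z, 'p) pomdp_ir \<Rightarrow> (('s \<Rightarrow> real) \<Rightarrow> 'a \<times> 'p) \<Rightarrow> nat \<Rightarrow> ('s \<Rightarrow> real) \<Rightarrow> real" where
  "value_ir M \<pi> 0 = (\<lambda>b. expected_reward M b (snd (\<pi> b)))"
| "value_ir M \<pi> (Suc t) = (\<lambda>b. expected_reward M b (snd (\<pi> b)) +
     (\<Sum>z\<in>possible_obs M b (fst (\<pi> b)).
        obs_given_belief M b (fst (\<pi> b)) z * value_ir M \<pi> t (update M b (fst (\<pi> b)) z)))"

text \<open>\<open>P\<close> is the set of prediction actions and \<open>\<alpha> p\<close> the vector of the prediction action \<open>p\<close>.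
  The construction is meant for \<open>\<alpha>\<close> a bijection from \<open>P\<close> onto the vectors of \<open>M\<close>.\<close>

definition reduce_pomdp ::
    "'p set \<Rightarrow> ('p \<Rightarrow> 's \<Rightarrow> real) \<Rightarrow> ('s, 'a, 'z) rho_pomdp \<Rightarrow> ('s, 'a, 'z, 'p) pomdp_ir" where
  "reduce_pomdp P \<alpha> M =
     \<lparr> states = states M, actions = actions M, observations = observations M,
       trans_prob = trans_prob M, obs_prob = obs_prob M,
       init_belief = init_belief M, horizon = horizon M,
       pred_actions = P, reward = (\<lambda>s p. \<alpha> p s) \<rparr>"

text \<open>The reduction of policies is a relation because the maximizer need not be unique.\<close>

definition policy_reduction ::
    "('s, 'a, 'z, 'p) pomdp_ir \<Rightarrow> (('s \<Rightarrow> real) \<Rightarrow> 'a) \<Rightarrow> (('s \<Rightarrow> real) \<Rightarrow> 'a \<times> 'p) \<Rightarrow> bool" where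
  "policy_reduction M \<pi>\<^sub>\<rho> \<pi>\<^sub>I\<^sub>R \<longleftrightarrow>
     (\<forall>b\<in>beliefs M. fst (\<pi>\<^sub>I\<^sub>R b) = \<pi>\<^sub>\<rho> b \<and>
        is_arg_max (expected_reward M b) (\<lambda>p. p \<in> pred_actions M) (snd (\<pi>\<^sub>I\<^sub>R b)))"

lemma is_pomdp_ir_reduce_pomdp:
  assumes "is_rho_pomdp M" and "bij_betw \<alpha> P (vectors M)"
  shows "is_pomdp_ir (reduce_pomdp P \<alpha> M)"
  using assms bij_betw_finite[OF assms(2)]
  by (auto simp: is_rho_pomdp_def is_pomdp_ir_def wf_process_def reduce_pomdp_def beliefs_def
      bij_betw_def)

end

theory Submission
  imports Defs
begin

text \<open>Along any play both models pass through the same beliefs, because updated beliefs are again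
  beliefs and transitions and observations agree. At each belief the maximizing prediction action
  collects exactly the maximum defining the belief reward.\<close>

text \<open>Needed because \<open>policy_reduction\<close> and the typing of the policy constrain
  choices on \<open>beliefs\<close> only. Bayes' rule divides nonnegative weights by their total,
  which is positive for an observation in \<open>possible_obs\<close>.\<close>

lemma update_in_beliefs:
  assumes wf: "wf_process M" and b: "b \<in> beliefs M" and a: "a \<in> actions M"
    and z: "z \<in> possible_obs M b a"
  shows "update M b a z \<in> beliefs M"
proof -
  let ?N = "obs_given_belief M b a z"
  have N: "?N \<noteq> 0" and zO: "z \<in> observations M"
    using z by (auto simp: possible_obs_def)
  have b0: "b s \<ge> 0" if "s \<in> states M" for s
    using b that by (auto simp: beliefs_def distributions_def)
  have T0: "trans_prob M s a s' \<ge> 0" if "s \<in> states M" "s' \<in> states M" for s s'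
    using wf a that by (auto simp: wf_process_def distributions_def)
  have O0: "obs_prob M s' a z \<ge> 0" if "s' \<in> states M" for s'
    using wf a that zO by (auto simp: wf_process_def distributions_def)
  have N0: "?N \<ge> 0"
    unfolding obs_given_belief_def by (intro sum_nonneg mult_nonneg_nonneg b0 T0 O0)
  have nonneg: "update M b a z s' \<ge> 0" if "s' \<in> states M" for s'
    using that by (auto simp: update_def intro!: mult_nonneg_nonneg divide_nonneg_nonneg
        sum_nonneg b0 T0 O0 N0)
  \<comment> \<open>Summing over the successor state first exhibits \<open>?N\<close> as the total
    of the unnormalized posterior weights.\<close>
  have "?N = (\<Sum>s'\<in>states M. obs_prob M s' a z * (\<Sum>s\<in>states M. b s * trans_prob M s a s'))"
    unfolding obs_given_belief_def
    by (subst sum.swap) (simp add: sum_distrib_left mult_ac)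
  moreover have "(\<Sum>s'\<in>states M. update M b a z s') =
      (\<Sum>s'\<in>states M. obs_prob M s' a z * (\<Sum>s\<in>states M. b s * trans_prob M s a s')) / ?N"
    by (simp add: update_def sum_divide_distrib)
  ultimately have "(\<Sum>s'\<in>states M. update M b a z s') = 1"
    using N by simp
  \<comment> \<open>The final \<open>simp\<close> handles states outside \<open>states M\<close>,
    where \<open>update\<close> takes its default value 0.\<close>
  with nonneg show ?thesis
    by (auto simp: beliefs_def distributions_def) (simp add: update_def)
qed

lemma reduce_pomdp_simps [simp]:
  "beliefs (reduce_pomdp P \<alpha> M) = beliefs M"
  "obs_given_belief (reduce_pomdp P \<alpha> M) = obs_given_belief M"
  "possible_obs (reduce_pomdp P \<alpha> M) = possible_obs M"
  "update (reduce_pomdp P \<alpha> M) = update M"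
  by (simp_all add: fun_eq_iff reduce_pomdp_def beliefs_def obs_given_belief_def possible_obs_def
      update_def)

text \<open>Reindexing along \<alpha> turns the maximum over vectors into one over \<open>P\<close>,
  and every maximizer attains it, however ties are broken.\<close>

lemma expected_reward_arg_max:
  assumes "finite (vectors M)" and "\<alpha> ` P = vectors M"
    and "is_arg_max (expected_reward (reduce_pomdp P \<alpha> M) b) (\<lambda>p. p \<in> P) p"
  shows "expected_reward (reduce_pomdp P \<alpha> M) b p = rho M b"
proof -
  have "rho M b = (MAX q\<in>P. expected_reward (reduce_pomdp P \<alpha> M) b q)"
    by (simp add: rho_def expected_reward_def reduce_pomdp_def image_image flip: assms(2))
  \<comment> \<open>\<open>Max_eqI\<close> needs finiteness; it comes from \<open>vectors M\<close>,
    since the reward of \<open>q\<close> depends on \<open>q\<close> only through its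
    vector.\<close>
  moreover have "finite (expected_reward (reduce_pomdp P \<alpha> M) b ` P)"
  proof -
    have "expected_reward (reduce_pomdp P \<alpha> M) b ` P =
        (\<lambda>v. \<Sum>s\<in>states M. b s * v s) ` vectors M"
      by (simp add: expected_reward_def reduce_pomdp_def image_image flip: assms(2))
    with assms(1) show ?thesis by simp
  qed
  ultimately show ?thesis
    using assms(3) by (auto simp: is_arg_max_linorder intro!: Max_eqI[symmetric])
qed

theorem theorem1:
  fixes M\<^sub>\<rho> :: "('s, 'a, 'z) rho_pomdp"
    and \<pi>\<^sub>\<rho> :: "('s \<Rightarrow> real) \<Rightarrow> 'a"
    and P :: "'p set" and \<alpha> :: "'p \<Rightarrow> 's \<Rightarrow> real"
    and M\<^sub>I\<^sub>R :: "('s, 'a, 'z, 'p) pomdp_ir"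
    and \<pi>\<^sub>I\<^sub>R :: "('s \<Rightarrow> real) \<Rightarrow> 'a \<times> 'p"
  assumes "is_rho_pomdp M\<^sub>\<rho>"
    and "\<pi>\<^sub>\<rho> \<in> beliefs M\<^sub>\<rho> \<rightarrow> actions M\<^sub>\<rho>"
    and "bij_betw \<alpha> P (vectors M\<^sub>\<rho>)"
    and "M\<^sub>I\<^sub>R = reduce_pomdp P \<alpha> M\<^sub>\<rho>"
    and "policy_reduction M\<^sub>I\<^sub>R \<pi>\<^sub>\<rho> \<pi>\<^sub>I\<^sub>R"
  shows "\<forall>b\<in>beliefs M\<^sub>\<rho>. \<forall>t. value_ir M\<^sub>I\<^sub>R \<pi>\<^sub>I\<^sub>R t b = value_rho M\<^sub>\<rho> \<pi>\<^sub>\<rho> t b"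
proof (intro ballI allI)
  have reward: "expected_reward M\<^sub>I\<^sub>R b (snd (\<pi>\<^sub>I\<^sub>R b)) = rho M\<^sub>\<rho> b" if "b \<in> beliefs M\<^sub>\<rho>" for b
    unfolding assms(4)
  proof (rule expected_reward_arg_max)
    show "finite (vectors M\<^sub>\<rho>)" using assms(1) by (simp add: is_rho_pomdp_def)
    show "\<alpha> ` P = vectors M\<^sub>\<rho>" using assms(3) by (simp add: bij_betw_def)
    show "is_arg_max (expected_reward (reduce_pomdp P \<alpha> M\<^sub>\<rho>) b) (\<lambda>p. p \<in> P) (snd (\<pi>\<^sub>I\<^sub>R b))"
      using assms(4,5) that by (simp add: policy_reduction_def) (simp add: reduce_pomdp_def)
  qed
  fix b t
  assume "b \<in> beliefs M\<^sub>\<rho>"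
  \<comment> \<open>The belief varies in the induction, as the recursion evaluates the shorter
    horizon at updated beliefs.\<close>
  then show "value_ir M\<^sub>I\<^sub>R \<pi>\<^sub>I\<^sub>R t b = value_rho M\<^sub>\<rho> \<pi>\<^sub>\<rho> t b"
  proof (induction t arbitrary: b)
    case 0
    then show ?case by (simp add: reward)
  next
    case (Suc t)
    have "fst (\<pi>\<^sub>I\<^sub>R b) = \<pi>\<^sub>\<rho> b"
      using assms(4,5) Suc.prems by (simp add: policy_reduction_def)
    \<comment> \<open>This supplies the premise of the induction hypothesis for exactly the
      observations that the sum ranges over.\<close>
    moreover have "update M\<^sub>\<rho> b (\<pi>\<^sub>\<rho> b) z \<in> beliefs M\<^sub>\<rho>" if "z \<in> possible_obs M\<^sub>\<rho> b (\<pi>\<^sub>\<rho> b)" for z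
      using assms(1,2) Suc.prems that by (auto simp: is_rho_pomdp_def intro!: update_in_beliefs)
    \<comment> \<open>The hypothesis is unfolded with \<open>assms(4)\<close> to match the goal,
      where \<open>M\<^sub>I\<^sub>R\<close> is rewritten too.\<close>
    ultimately show ?case
      using reward[OF Suc.prems] by (simp add: assms(4) Suc.IH[unfolded assms(4)])
  qed
qed

end
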